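(* Let $\mathcal F^{(1)},\mathcal F^{(2)}:\mathbb R\times\mathbb R\to\mathbb R$ be two classical numerical fluxes for the same scalar conservation law $\partial_tu+\partial_xf(u)=0$, let $\delta,\Delta x,\Delta t>0$, and define the corresponding quantised interface transfer rules by $$\Phi^{(k)}(q_L,q_R):=\mathrm{round}\!\left(\mathcal F^{(k)}(\delta q_L,\delta q_R)\frac{\Delta t}{\Delta x}\delta^{-1}\right),\qquad q_L,q_R\in\mathbb Z,\ k\in\{1,2\}.$$ If $\Phi^{(1)}(q_L,q_R)=\Phi^{(2)}(q_L,q_R)$ for every interface state $(q_L,q_R)$ visited during the evolution, then the induced updates $$q_i^{n+1}=q_i^n-\bigl(\Phi^{(k)}(q_i^n,q_{i+1}^n)-\Phi^{(k)}(q_{i-1}^n,q_i^n)\bigr),\qquad k\in\{1,2\},$$ are identical for all timesteps from the same initial data. In particular, the discrete dynamics are determined by the induced integer transfer rule rather than by the specific continuous flux formula used before quantisation.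
   Context: Setting: a uniform one-dimensional grid with integer cell states $q_i^n\in\mathbb Z$ ($i$ the cell index, $n$ the time level). $\mathrm{round}:\mathbb R\to\mathbb Z$ is rounding to the nearest integer. A classical (two-point) numerical flux is a real-valued function $\mathcal F(u_L,u_R)$ of the left and right states. The interface states visited during the evolution are the pairs $(q_i^n,q_{i+1}^n)$ of neighbouring states occurring at some cell $i$ and time level $n$ of the computation started from the given initial data. *)

theory Defs
  imports Complex_Main
begin

text \<open>
  A two-point numerical flux is any function of type \<open>real \<Rightarrow> real \<Rightarrow> real\<close>; no consistency condition
  \<open>F u u = f u\<close> with the physical flux \<open>f\<close> of the conservation law is imposed.
  Cells are indexed by \<open>int\<close>, so the stencil \<open>i - 1, i, i + 1\<close> is available at every cell;
  a periodic grid is the case of periodic data.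
\<close>

type_synonym num_flux = "real \<Rightarrow> real \<Rightarrow> real"

text \<open>The library's \<^const>\<open>round\<close> is rounding to the nearest integer, with ties rounded up.\<close>

definition transfer_rule :: "real \<Rightarrow> real \<Rightarrow> real \<Rightarrow> num_flux \<Rightarrow> int \<Rightarrow> int \<Rightarrow> int" where
  "transfer_rule \<delta> \<Delta>x \<Delta>t F qL qR =
     round (F (\<delta> * of_int qL) (\<delta> * of_int qR) * (\<Delta>t / \<Delta>x) * inverse \<delta>)"

primrec evolution ::
  "real \<Rightarrow> real \<Rightarrow> real \<Rightarrow> num_flux \<Rightarrow> (int \<Rightarrow> int) \<Rightarrow> nat \<Rightarrow> int \<Rightarrow> int" where
  "evolution \<delta> \<Delta>x \<Delta>t F q0 0 = q0"
| "evolution \<delta> \<Delta>x \<Delta>t F q0 (Suc n) = (\<lambda>i.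
     let q = evolution \<delta> \<Delta>x \<Delta>t F q0 n in
     q i - (transfer_rule \<delta> \<Delta>x \<Delta>t F (q i) (q (i + 1))
            - transfer_rule \<delta> \<Delta>x \<Delta>t F (q (i - 1)) (q i)))"

definition visited_interfaces ::
  "real \<Rightarrow> real \<Rightarrow> real \<Rightarrow> num_flux \<Rightarrow> (int \<Rightarrow> int) \<Rightarrow> (int \<times> int) set" where
  "visited_interfaces \<delta> \<Delta>x \<Delta>t F q0 =
     {(evolution \<delta> \<Delta>x \<Delta>t F q0 n i, evolution \<delta> \<Delta>x \<Delta>t F q0 n (i + 1)) | n i. True}"

end

theory Submission
  imports Defs
begin

text \<open>The flux enters an update only through the integers that the transfer rule returns at
  the interfaces of the current time level. If two trajectories coincide at level \<open>n\<close>,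
  all their interface pairs there are visited ones, so agreeing rules give the same level
  \<open>n + 1\<close>; induction on time, in \<open>evolution_eq_if_transfer_rules_agree\<close>,
  does the rest. For the second claim, the scheme is run with an arbitrary integer rule in place of
  a flux: \<open>rule_evolution\<close> is one map that serves every flux, by
  \<open>evolution_eq_rule_evolution\<close>.\<close>

primrec rule_evolution :: "(int \<Rightarrow> int \<Rightarrow> int) \<Rightarrow> (int \<Rightarrow> int) \<Rightarrow> nat \<Rightarrow> int \<Rightarrow> int" where
  "rule_evolution \<Phi> q0 0 = q0"
| "rule_evolution \<Phi> q0 (Suc n) = (\<lambda>i.
     let q = rule_evolution \<Phi> q0 n in
     q i - (\<Phi> (q i) (q (i + 1)) - \<Phi> (q (i - 1)) (q i)))"

lemma evolution_eq_rule_evolution: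
  "evolution \<delta> \<Delta>x \<Delta>t G q0 n = rule_evolution (transfer_rule \<delta> \<Delta>x \<Delta>t G) q0 n"
  by (induction n) simp_all

text \<open>Agreement along the trajectory of \<open>G\<close> alone suffices: by induction
  \<open>H\<close> has followed the same states so far, so its next update consults only pairs
  visited by \<open>G\<close>.\<close>

lemma evolution_eq_if_transfer_rules_agree:
  assumes agree: "\<And>qL qR. (qL, qR) \<in> visited_interfaces \<delta> \<Delta>x \<Delta>t G q0 \<Longrightarrow>
    transfer_rule \<delta> \<Delta>x \<Delta>t G qL qR = transfer_rule \<delta> \<Delta>x \<Delta>t H qL qR"
  shows "evolution \<delta> \<Delta>x \<Delta>t G q0 n = evolution \<delta> \<Delta>x \<Delta>t H q0 n"
proof (induction n)
  case 0
  show ?case by simp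
next
  case (Suc n)
  let ?q = "evolution \<delta> \<Delta>x \<Delta>t G q0 n"
  have right: "transfer_rule \<delta> \<Delta>x \<Delta>t G (?q i) (?q (i + 1)) =
      transfer_rule \<delta> \<Delta>x \<Delta>t H (?q i) (?q (i + 1))" for i
    by (rule agree) (auto simp: visited_interfaces_def)
  \<comment> \<open>The left interface of cell \<open>i\<close> is the right interface of cell
    \<open>i - 1\<close>.\<close>
  have left: "transfer_rule \<delta> \<Delta>x \<Delta>t G (?q (i - 1)) (?q i) =
      transfer_rule \<delta> \<Delta>x \<Delta>t H (?q (i - 1)) (?q i)" for i
    using right[of "i - 1"] by simp
  \<comment> \<open>The flipped induction hypothesis turns the states of \<open>H\<close> into those
    of \<open>G\<close>, where \<open>right\<close> and \<open>left\<close> apply.\<close>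
  show ?case
    by (simp add: Let_def right left flip: Suc.IH)
qed

theorem theorem2p5:
  fixes F :: "nat \<Rightarrow> num_flux" and \<delta> \<Delta>x \<Delta>t :: real
  assumes "\<delta> > 0" and "\<Delta>x > 0" and "\<Delta>t > 0"
  shows "(\<forall>q0. \<forall>k \<in> {1, 2}.
            (\<forall>(qL, qR) \<in> visited_interfaces \<delta> \<Delta>x \<Delta>t (F k) q0.
               transfer_rule \<delta> \<Delta>x \<Delta>t (F 1) qL qR = transfer_rule \<delta> \<Delta>x \<Delta>t (F 2) qL qR) \<longrightarrow>
            (\<forall>n i. evolution \<delta> \<Delta>x \<Delta>t (F 1) q0 n i = evolution \<delta> \<Delta>x \<Delta>t (F 2) q0 n i)) \<and>
         (\<exists>D :: (int \<Rightarrow> int \<Rightarrow> int) \<Rightarrow> (int \<Rightarrow> int) \<Rightarrow> nat \<Rightarrow> int \<Rightarrow> int.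
            \<forall>G :: num_flux. \<forall>q0.
              evolution \<delta> \<Delta>x \<Delta>t G q0 = D (transfer_rule \<delta> \<Delta>x \<Delta>t G) q0)"
proof (intro conjI allI ballI impI)
  fix q0 :: "int \<Rightarrow> int" and k n :: nat and i :: int
  assume k: "k \<in> {1, 2}"
    and agree: "\<forall>(qL, qR) \<in> visited_interfaces \<delta> \<Delta>x \<Delta>t (F k) q0.
      transfer_rule \<delta> \<Delta>x \<Delta>t (F 1) qL qR = transfer_rule \<delta> \<Delta>x \<Delta>t (F 2) qL qR"
  from k consider "k = 1" | "k = 2" by blast
  then have "evolution \<delta> \<Delta>x \<Delta>t (F 1) q0 n = evolution \<delta> \<Delta>x \<Delta>t (F 2) q0 n"
  proof cases
    case 1
    then show ?thesis
      using agree by (intro evolution_eq_if_transfer_rules_agree) blast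
  next
    \<comment> \<open>Now the visited pairs are those of \<open>F 2\<close>, so the lemma is used
      with the two fluxes exchanged.\<close>
    case 2
    then show ?thesis
      using agree by (intro evolution_eq_if_transfer_rules_agree[symmetric]) force
  qed
  then show "evolution \<delta> \<Delta>x \<Delta>t (F 1) q0 n i = evolution \<delta> \<Delta>x \<Delta>t (F 2) q0 n i"
    by simp
next
  \<comment> \<open>The witness is chosen before \<open>G\<close> and \<open>q0\<close>, so the flux
    can reach it only through its transfer rule.\<close>
  show "\<exists>D. \<forall>G q0. evolution \<delta> \<Delta>x \<Delta>t G q0 = D (transfer_rule \<delta> \<Delta>x \<Delta>t G) q0"
    by (intro exI[of _ rule_evolution] allI ext) (simp add: evolution_eq_rule_evolution)
qed

end
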